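(* Let $K$ be a finite abstract simplicial complex and let $K_0$ be its core. Then $\mathrm{scat}\,K$ is strictly smaller than the number of vertices of $K_0$, and $\mathrm{scat}\,K$ is strictly smaller than the number of maximal simplices of $K_0$.
   Context: Two simplicial maps $\varphi,\psi\colon K\to L$ between abstract simplicial complexes are contiguous, $\varphi\sim_c\psi$, if for every simplex $\sigma$ of $K$ the set of vertices $\varphi(\sigma)\cup\psi(\sigma)$ is a simplex of $L$. They are in the same contiguity class, $\varphi\sim\psi$, if there is a finite sequence of simplicial maps $\varphi=\varphi_1\sim_c\varphi_2\sim_c\cdots\sim_c\varphi_m=\psi$ from $K$ to $L$. A subcomplex $U\subset K$ is categorical (in $K$) if there is a vertex $v\in K$ such that the inclusion $U\to K$ and the constant map $c_v\colon U\to K$ with value $v$ are in the same contiguity class. The simplicial LS-category $\mathrm{scat}\, K$ is the least integer $n\geq 0$ such that $K=U_0\cup\cdots\cup U_n$ for some $n+1$ categorical subcomplexes $U_0,\dots,U_n$ of $K$. Complexes are assumed nonempty. A vertex $v$ of $K$ is dominated by another vertex $v'\neq v$ if every maximal simplex of $K$ containing $v$ also contains $v'$. An elementary strong collapse consists of removing from $K$ the open star of a dominated vertex $v$ (i.e. all simplices containing $v$). The core $K_0$ of $K$ is the subcomplex obtained by performing elementary strong collapses until no dominated vertex remains; it is unique up to simplicial isomorphism. *)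

theory Defs
  imports Main "HOL-Library.Extended_Nat"
begin

(* A complex is its set of simplices.  The empty set is not counted as a simplex, and
   complexes are nonempty. *)

definition abstract_simplicial_complex :: "'a set set \<Rightarrow> bool" where
  "abstract_simplicial_complex K \<longleftrightarrow>
     K \<noteq> {} \<and>
     (\<forall>\<sigma>\<in>K. finite \<sigma> \<and> \<sigma> \<noteq> {}) \<and>
     (\<forall>\<sigma>\<in>K. \<forall>\<tau>. \<tau> \<noteq> {} \<and> \<tau> \<subseteq> \<sigma> \<longrightarrow> \<tau> \<in> K)"

definition vertices :: "'a set set \<Rightarrow> 'a set" where
  "vertices K = {v. {v} \<in> K}"

definition maximal_simplices :: "'a set set \<Rightarrow> 'a set set" where
  "maximal_simplices K = {\<sigma> \<in> K. \<forall>\<tau>\<in>K. \<sigma> \<subseteq> \<tau> \<longrightarrow> \<tau> = \<sigma>}"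

definition subcomplex :: "'a set set \<Rightarrow> 'a set set \<Rightarrow> bool" where
  "subcomplex U K \<longleftrightarrow> abstract_simplicial_complex U \<and> U \<subseteq> K"

(* Simplicial maps are total functions on the vertex type; their values off the vertices of
   the source are irrelevant.  In particular two simplicial maps that agree on the vertices
   are contiguous, so contiguity classes do not depend on these values either. *)

definition simplicial_map :: "'a set set \<Rightarrow> 'b set set \<Rightarrow> ('a \<Rightarrow> 'b) \<Rightarrow> bool" where
  "simplicial_map K L f \<longleftrightarrow> (\<forall>\<sigma>\<in>K. f ` \<sigma> \<in> L)"

definition contiguous :: "'a set set \<Rightarrow> 'b set set \<Rightarrow> ('a \<Rightarrow> 'b) \<Rightarrow> ('a \<Rightarrow> 'b) \<Rightarrow> bool" where
  "contiguous K L f g \<longleftrightarrow>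
     simplicial_map K L f \<and> simplicial_map K L g \<and> (\<forall>\<sigma>\<in>K. f ` \<sigma> \<union> g ` \<sigma> \<in> L)"

definition same_contiguity_class ::
    "'a set set \<Rightarrow> 'b set set \<Rightarrow> ('a \<Rightarrow> 'b) \<Rightarrow> ('a \<Rightarrow> 'b) \<Rightarrow> bool" where
  "same_contiguity_class K L f g \<longleftrightarrow>
     simplicial_map K L f \<and> simplicial_map K L g \<and> (contiguous K L)\<^sup>*\<^sup>* f g"

definition categorical :: "'a set set \<Rightarrow> 'a set set \<Rightarrow> bool" where
  "categorical U K \<longleftrightarrow>
     subcomplex U K \<and> (\<exists>v\<in>vertices K. same_contiguity_class U K id (\<lambda>_. v))"

(* scat K is \<infinity> if there is no finite cover by categorical subcomplexes. *)

definition scat :: "'a set set \<Rightarrow> enat" where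
  "scat K = Inf {enat n |n. \<exists>U. (\<forall>i\<le>n. categorical (U i) K) \<and> K = (\<Union>i\<le>n. U i)}"

definition dominated_by :: "'a set set \<Rightarrow> 'a \<Rightarrow> 'a \<Rightarrow> bool" where
  "dominated_by K v v' \<longleftrightarrow>
     v \<in> vertices K \<and> v' \<in> vertices K \<and> v' \<noteq> v \<and>
     (\<forall>\<sigma>\<in>maximal_simplices K. v \<in> \<sigma> \<longrightarrow> v' \<in> \<sigma>)"

definition open_star :: "'a set set \<Rightarrow> 'a \<Rightarrow> 'a set set" where
  "open_star K v = {\<sigma> \<in> K. v \<in> \<sigma>}"

definition elementary_strong_collapse :: "'a set set \<Rightarrow> 'a set set \<Rightarrow> bool" where
  "elementary_strong_collapse K L \<longleftrightarrow> (\<exists>v v'. dominated_by K v v' \<and> L = K - open_star K v)"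

(* The core is determined only up to isomorphism, hence a relation: is_core K K0 holds for
   every possible outcome K0 of maximally collapsing K. *)

definition is_core :: "'a set set \<Rightarrow> 'a set set \<Rightarrow> bool" where
  "is_core K K0 \<longleftrightarrow>
     elementary_strong_collapse\<^sup>*\<^sup>* K K0 \<and> \<not> (\<exists>v v'. dominated_by K0 v v')"

lemma core_exists:
  assumes "finite K"
  shows "\<exists>K0. is_core K K0"
  using assms
proof (induction K rule: finite_psubset_induct)
  case (psubset K)
  show ?case
  proof (cases "\<exists>v v'. dominated_by K v v'")
    case False
    then show ?thesis by (auto simp: is_core_def)
  next
    case True
    then obtain v v' where d: "dominated_by K v v'" by blast
    let ?L = "K - open_star K v"
    have "{v} \<in> open_star K v" "{v} \<in> K"
      using d by (auto simp: dominated_by_def vertices_def open_star_def)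
    then have "?L \<subset> K" by blast
    then obtain K0 where K0: "is_core ?L K0" using psubset.IH by blast
    have "elementary_strong_collapse K ?L"
      using d by (auto simp: elementary_strong_collapse_def)
    then show ?thesis
      using K0 by (auto simp: is_core_def intro: converse_rtranclp_into_rtranclp)
  qed
qed

end

(* Collapsing a dominated vertex v to a vertex v' dominating it is a simplicial retraction
   contiguous to the identity, so composing collapses yields a retraction r of K onto K0 in the
   contiguity class of the identity.  The preimage under r of the closed star of a vertex of K0,
   or of a single simplex of K0, is then categorical: there the inclusion is in the class of r,
   and r is contiguous to a constant map.  The closed stars of all vertices, and likewise the
   maximal simplices, cover K0, so their preimages cover K. *)
theory Submission
  imports Defs
begin

section \<open>Faces, vertices and maximal simplices of a finite complex\<close>

lemma simplex_in_maximal_simplex: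
  assumes "finite K" and "\<sigma> \<in> K"
  obtains \<tau> where "\<tau> \<in> maximal_simplices K" and "\<sigma> \<subseteq> \<tau>"
proof -
  obtain \<tau> where "\<tau> \<in> K" "\<sigma> \<subseteq> \<tau>" "\<forall>\<rho>\<in>K. \<tau> \<subseteq> \<rho> \<longrightarrow> \<rho> = \<tau>"
    using finite_has_maximal2[OF assms] by metis
  then show thesis
    by (intro that[of \<tau>]) (simp_all add: maximal_simplices_def)
qed

lemma finite_vertices:
  assumes "finite K"
  shows "finite (vertices K)"
proof -
  have "vertices K = (\<lambda>v. {v}) -` K"
    by (auto simp: vertices_def)
  then show ?thesis
    using assms by (simp add: finite_vimageI inj_def)
qed

lemma complex_face:
  "abstract_simplicial_complex K \<Longrightarrow> \<sigma> \<in> K \<Longrightarrow> \<tau> \<noteq> {} \<Longrightarrow> \<tau> \<subseteq> \<sigma> \<Longrightarrow> \<tau> \<in> K"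
  unfolding abstract_simplicial_complex_def by blast

lemma complex_simplex_nonempty:
  "abstract_simplicial_complex K \<Longrightarrow> \<sigma> \<in> K \<Longrightarrow> \<sigma> \<noteq> {}"
  unfolding abstract_simplicial_complex_def by blast

lemma simplex_vertex:
  "abstract_simplicial_complex K \<Longrightarrow> \<sigma> \<in> K \<Longrightarrow> x \<in> \<sigma> \<Longrightarrow> x \<in> vertices K"
  unfolding vertices_def using complex_face[of K \<sigma> "{x}"] by simp

text \<open>Domination speaks only of maximal simplices. Finiteness of \<open>K\<close> extends
  \<open>\<sigma>\<close> to a maximal simplex, which then contains \<open>v'\<close>, and the
  enlarged set is a face of it.\<close>

lemma insert_dominating_vertex:
  assumes "abstract_simplicial_complex K" and "finite K" and "dominated_by K v v'"
    and "\<sigma> \<in> K" and "v \<in> \<sigma>"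
  shows "insert v' \<sigma> \<in> K"
proof -
  obtain \<tau> where \<tau>: "\<tau> \<in> maximal_simplices K" "\<sigma> \<subseteq> \<tau>"
    using assms(2,4) by (rule simplex_in_maximal_simplex)
  have "v' \<in> \<tau>"
    using assms(3,5) \<tau> unfolding dominated_by_def by blast
  moreover have "\<tau> \<in> K"
    using \<tau>(1) by (simp add: maximal_simplices_def)
  ultimately show ?thesis
    using \<tau>(2) assms(4,5) complex_face[OF assms(1), of \<tau> "insert v' \<sigma>"] by simp
qed

lemma subcomplexI:
  assumes "abstract_simplicial_complex K" and "U \<noteq> {}" and "U \<subseteq> K"
    and "\<And>\<sigma> \<tau>. \<sigma> \<in> U \<Longrightarrow> \<tau> \<noteq> {} \<Longrightarrow> \<tau> \<subseteq> \<sigma> \<Longrightarrow> \<tau> \<in> U"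
  shows "subcomplex U K"
proof -
  have "\<forall>\<sigma>\<in>U. finite \<sigma> \<and> \<sigma> \<noteq> {}"
    using assms(1,3) by (simp add: abstract_simplicial_complex_def subset_iff)
  moreover have "\<forall>\<sigma>\<in>U. \<forall>\<tau>. \<tau> \<noteq> {} \<and> \<tau> \<subseteq> \<sigma> \<longrightarrow> \<tau> \<in> U"
    by (intro ballI allI impI, elim conjE) (rule assms(4))
  ultimately show ?thesis
    unfolding subcomplex_def abstract_simplicial_complex_def
    using assms(2,3) by (intro conjI)
qed

section \<open>Strong collapses as retractions in the contiguity class of the identity\<close>

lemma complex_elementary_strong_collapse:
  assumes "abstract_simplicial_complex K" and "elementary_strong_collapse K L"
  shows "abstract_simplicial_complex L"
proof -
  obtain v v' where d: "dominated_by K v v'" and L: "L = K - open_star K v"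
    using assms(2) by (auto simp: elementary_strong_collapse_def)
  \<comment> \<open>The dominating vertex survives the collapse, so \<open>L\<close> is
    nonempty.\<close>
  have "{v'} \<in> L"
    using d by (auto simp: L dominated_by_def vertices_def open_star_def)
  have "subcomplex L K"
  proof (rule subcomplexI[OF assms(1)])
    show "L \<noteq> {}" "L \<subseteq> K"
      using \<open>{v'} \<in> L\<close> by (auto simp: L)
    show "\<tau> \<in> L" if "\<sigma> \<in> L" "\<tau> \<noteq> {}" "\<tau> \<subseteq> \<sigma>" for \<sigma> \<tau>
      using that complex_face[OF assms(1) _ that(2,3)] by (auto simp: L open_star_def)
  qed
  then show ?thesis
    by (simp add: subcomplex_def)
qed

text \<open>A combinatorial analogue of a deformation retraction. The chain from \<open>id\<close>
  to \<open>r\<close> runs through self-maps of \<open>K\<close>, and its intermediate maps may move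
  the vertices of \<open>L\<close>.\<close>

definition contiguity_retraction :: "'a set set \<Rightarrow> 'a set set \<Rightarrow> ('a \<Rightarrow> 'a) \<Rightarrow> bool" where
  "contiguity_retraction K L r \<longleftrightarrow>
     simplicial_map K L r \<and> (\<forall>x\<in>vertices L. r x = x) \<and> (contiguous K K)\<^sup>*\<^sup>* id r"

lemma contiguity_retraction_id: "contiguity_retraction K K id"
  by (simp add: contiguity_retraction_def simplicial_map_def)

text \<open>The retraction sends \<open>v\<close> to \<open>v'\<close> and fixes everything else. A
  simplex together with its image is then either the simplex itself or the simplex with
  \<open>v'\<close> added.\<close>

lemma contiguity_retraction_elementary:
  assumes "abstract_simplicial_complex K" and "finite K" and "elementary_strong_collapse K L"
  shows "\<exists>r. contiguity_retraction K L r"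
proof -
  obtain v v' where d: "dominated_by K v v'" and L: "L = K - open_star K v"
    using assms(3) by (auto simp: elementary_strong_collapse_def)
  let ?r = "id(v := v')"
  have union: "\<sigma> \<union> ?r ` \<sigma> \<in> K" if "\<sigma> \<in> K" for \<sigma>
  proof (cases "v \<in> \<sigma>")
    case True
    then have "\<sigma> \<union> ?r ` \<sigma> = insert v' \<sigma>" by auto
    then show ?thesis
      using insert_dominating_vertex[OF assms(1,2) d that True] by simp
  next
    case False
    then have "\<sigma> \<union> ?r ` \<sigma> = \<sigma>" by auto
    then show ?thesis using that by simp
  qed
  \<comment> \<open>The image is a nonempty face of the union just shown to be a simplex.\<close>
  have image: "?r ` \<sigma> \<in> K" if "\<sigma> \<in> K" for \<sigma>
    by (rule complex_face[OF assms(1) union[OF that]])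
      (use complex_simplex_nonempty[OF assms(1) that] in auto)
  have "v' \<noteq> v"
    using d by (simp add: dominated_by_def)
  then have "simplicial_map K L ?r"
    using image by (auto simp: simplicial_map_def L open_star_def)
  moreover have "contiguous K K id ?r"
    using union image by (simp add: contiguous_def simplicial_map_def)
  moreover have "\<forall>x\<in>vertices L. ?r x = x"
    by (auto simp: L vertices_def open_star_def)
  ultimately show ?thesis
    unfolding contiguity_retraction_def by blast
qed

text \<open>The target grows from \<open>L\<close> to \<open>M\<close> so that a contiguity inside a
  collapsed complex can be read in the original one.\<close>

lemma contiguous_comp:
  assumes "simplicial_map K L h" and "L \<subseteq> M" and "contiguous L L f g"
  shows "contiguous K M (f \<circ> h) (g \<circ> h)"
proof -
  have "(f \<circ> h) ` \<sigma> \<in> M \<and> (g \<circ> h) ` \<sigma> \<in> M \<and> (f \<circ> h) ` \<sigma> \<union> (g \<circ> h) ` \<sigma> \<in> M"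
    if "\<sigma> \<in> K" for \<sigma>
  proof -
    have "h ` \<sigma> \<in> L"
      using that assms(1) by (simp add: simplicial_map_def)
    then have "f ` h ` \<sigma> \<in> L" "g ` h ` \<sigma> \<in> L" "f ` h ` \<sigma> \<union> g ` h ` \<sigma> \<in> L"
      using assms(3) unfolding contiguous_def simplicial_map_def by blast+
    then show ?thesis
      using assms(2) unfolding image_comp by blast
  qed
  then show ?thesis
    by (simp add: contiguous_def simplicial_map_def)
qed

lemma contiguous_chain_comp:
  assumes "simplicial_map K L h" and "L \<subseteq> M" and "(contiguous L L)\<^sup>*\<^sup>* f g"
  shows "(contiguous K M)\<^sup>*\<^sup>* (f \<circ> h) (g \<circ> h)"
  using assms(3)
proof (induction rule: rtranclp_induct)
  case base
  show ?case ..
next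
  case (step g g')
  then show ?case
    using contiguous_comp[OF assms(1,2)] by (blast intro: rtranclp.rtrancl_into_rtrancl)
qed

text \<open>Precomposing the chain from \<open>id\<close> to \<open>s\<close> with \<open>r\<close>
  gives a chain in \<open>K\<close> from \<open>r\<close> to \<open>s \<circ> r\<close>, which is
  appended to the one from \<open>id\<close> to \<open>r\<close>.\<close>

lemma contiguity_retraction_comp:
  assumes "contiguity_retraction K L r" and "contiguity_retraction L M s"
    and "L \<subseteq> K" and "M \<subseteq> L"
  shows "contiguity_retraction K M (s \<circ> r)"
proof -
  have r: "simplicial_map K L r" "(contiguous K K)\<^sup>*\<^sup>* id r" "\<forall>x\<in>vertices L. r x = x"
    and s: "simplicial_map L M s" "(contiguous L L)\<^sup>*\<^sup>* id s" "\<forall>x\<in>vertices M. s x = x"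
    using assms(1,2) by (auto simp: contiguity_retraction_def)
  have "(contiguous K K)\<^sup>*\<^sup>* r (s \<circ> r)"
    using contiguous_chain_comp[OF r(1) assms(3) s(2)] by simp
  with r(2) have "(contiguous K K)\<^sup>*\<^sup>* id (s \<circ> r)"
    by (rule rtranclp_trans)
  moreover have "\<forall>x\<in>vertices M. (s \<circ> r) x = x"
    using r(3) s(3) assms(4) by (auto simp: vertices_def)
  moreover have "simplicial_map K M (s \<circ> r)"
    using r(1) s(1) unfolding simplicial_map_def image_comp[symmetric] by blast
  ultimately show ?thesis
    by (simp add: contiguity_retraction_def)
qed

text \<open>Induction that splits off the first collapse: the remaining ones start at the smaller
  complex, which is again a finite complex, and the two retractions compose.\<close>

lemma contiguity_retraction_strong_collapse:
  assumes "elementary_strong_collapse\<^sup>*\<^sup>* K L"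
    and "abstract_simplicial_complex K" and "finite K"
  shows "abstract_simplicial_complex L \<and> L \<subseteq> K \<and> (\<exists>r. contiguity_retraction K L r)"
  using assms
proof (induction rule: converse_rtranclp_induct)
  case base
  then show ?case using contiguity_retraction_id by blast
next
  case (step K M)
  have MK: "M \<subseteq> K"
    using step.hyps(1) by (auto simp: elementary_strong_collapse_def)
  have IH: "abstract_simplicial_complex L" "L \<subseteq> M" "\<exists>s. contiguity_retraction M L s"
    using step.IH complex_elementary_strong_collapse[OF step.prems(1) step.hyps(1)]
      finite_subset[OF MK step.prems(2)] by simp_all
  obtain r where "contiguity_retraction K M r"
    using contiguity_retraction_elementary[OF step.prems step.hyps(1)] by blast
  then show ?case
    using contiguity_retraction_comp[OF _ _ MK IH(2)] IH MK by blast
qed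

section \<open>Categorical subcomplexes and covers by them\<close>

lemma contiguous_chain_subcomplex:
  assumes "U \<subseteq> K" and "(contiguous K L)\<^sup>*\<^sup>* f g"
  shows "(contiguous U L)\<^sup>*\<^sup>* f g"
proof -
  \<comment> \<open>Fewer simplices in the source impose fewer conditions, so the relation grows and
    its closure grows with it.\<close>
  have "contiguous K L \<le> contiguous U L"
    using assms(1) unfolding contiguous_def simplicial_map_def by blast
  then show ?thesis
    using assms(2) rtranclp_mono by blast
qed

text \<open>The chain from \<open>id\<close> to \<open>r\<close> restricts to \<open>U\<close>, and
  one more step leads to the constant map.\<close>

lemma categorical_if_contiguous_to_constant:
  assumes "subcomplex U K" and "v \<in> vertices K" and "(contiguous K K)\<^sup>*\<^sup>* id r"
    and "contiguous U K r (\<lambda>_. v)"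
  shows "categorical U K"
proof -
  have "U \<subseteq> K"
    using assms(1) by (simp add: subcomplex_def)
  then have "(contiguous U K)\<^sup>*\<^sup>* id (\<lambda>_. v)"
    using assms(3,4) contiguous_chain_subcomplex rtranclp.rtrancl_into_rtrancl by metis
  moreover have "simplicial_map U K id"
    using \<open>U \<subseteq> K\<close> by (auto simp: simplicial_map_def)
  moreover have "simplicial_map U K (\<lambda>_. v)"
    using assms(4) by (simp add: contiguous_def)
  ultimately show ?thesis
    using assms(1,2) by (auto simp: categorical_def same_contiguity_class_def)
qed

text \<open>Stated for any property \<open>P\<close> inherited by nonempty subsets, to serve both
  closed stars and single simplices. The simplex \<open>\<sigma>\<close> witnesses
  nonemptiness.\<close>

lemma subcomplex_preimage:
  assumes "abstract_simplicial_complex K" and "\<sigma> \<in> K" and "P (r ` \<sigma>)"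
    and "\<And>\<alpha> \<beta>. P \<alpha> \<Longrightarrow> \<beta> \<noteq> {} \<Longrightarrow> \<beta> \<subseteq> \<alpha> \<Longrightarrow> P \<beta>"
  shows "subcomplex {\<sigma> \<in> K. P (r ` \<sigma>)} K"
proof (rule subcomplexI[OF assms(1)])
  show "{\<sigma> \<in> K. P (r ` \<sigma>)} \<noteq> {}" "{\<sigma> \<in> K. P (r ` \<sigma>)} \<subseteq> K"
    using assms(2,3) by auto
  fix \<rho> \<tau>
  assume "\<rho> \<in> {\<sigma> \<in> K. P (r ` \<sigma>)}" and \<tau>: "\<tau> \<noteq> {}" "\<tau> \<subseteq> \<rho>"
  then have "\<rho> \<in> K" "P (r ` \<rho>)"
    by simp_all
  moreover have "r ` \<tau> \<noteq> {}" "r ` \<tau> \<subseteq> r ` \<rho>"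
    using \<tau> by auto
  ultimately show "\<tau> \<in> {\<sigma> \<in> K. P (r ` \<sigma>)}"
    using assms(4) complex_face[OF assms(1) _ \<tau>] by simp
qed

lemma scat_less_card_cover:
  assumes "finite I" and "I \<noteq> {}" and "\<And>i. i \<in> I \<Longrightarrow> categorical (U i) K"
    and "K \<subseteq> (\<Union>i\<in>I. U i)"
  shows "scat K < enat (card I)"
proof -
  obtain h where h: "bij_betw h {..<card I} I"
    using ex_bij_betw_nat_finite[OF assms(1)] by (auto simp: atLeast0LessThan)
  \<comment> \<open>The pieces in \<open>scat\<close> are indexed from 0 to \<open>n\<close>, so
    \<open>card I\<close> pieces bound it by \<open>card I - 1\<close>; this is the source of the
    strict inequality.\<close>
  define n where "n = card I - 1"
  have card: "card I = Suc n"
    using assms(1,2) by (simp add: n_def card_gt_0_iff)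
  have I: "I = h ` {..n}"
    using h by (simp add: card lessThan_Suc_atMost bij_betw_def)
  have cat: "\<forall>i\<le>n. categorical ((U \<circ> h) i) K"
    using assms(3) I by simp
  then have "(\<Union>i\<le>n. (U \<circ> h) i) \<subseteq> K"
    by (auto simp: categorical_def subcomplex_def)
  then have "K = (\<Union>i\<le>n. (U \<circ> h) i)"
    using assms(4) by (auto simp: I)
  with cat have "scat K \<le> enat n"
    unfolding scat_def by (intro Inf_lower) blast
  then show ?thesis
    by (simp add: card order.strict_trans1)
qed

theorem corollary2p3p6:
  fixes K K0 :: "'a set set"
  assumes "abstract_simplicial_complex K" and "finite K" and "is_core K K0"
  shows "scat K < enat (card (vertices K0)) \<and> scat K < enat (card (maximal_simplices K0))"
proof -
  have "elementary_strong_collapse\<^sup>*\<^sup>* K K0"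
    using assms(3) by (simp add: is_core_def)
  then obtain r where K0: "abstract_simplicial_complex K0" "K0 \<subseteq> K"
    and "contiguity_retraction K K0 r"
    using contiguity_retraction_strong_collapse assms(1,2) by blast
  then have r: "\<And>\<sigma>. \<sigma> \<in> K \<Longrightarrow> r ` \<sigma> \<in> K0" "\<And>x. x \<in> vertices K0 \<Longrightarrow> r x = x"
    "(contiguous K K)\<^sup>*\<^sup>* id r"
    by (simp_all add: contiguity_retraction_def simplicial_map_def)
  have fin: "finite K0"
    using K0(2) assms(2) by (rule finite_subset)
  obtain \<sigma>0 where \<sigma>0: "\<sigma>0 \<in> K0"
    using K0(1) by (auto simp: abstract_simplicial_complex_def)
  have vert: "v \<in> vertices K" if "v \<in> vertices K0" for v
    using that K0(2) by (auto simp: vertices_def)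
  \<comment> \<open>A criterion for both covers: simplices are nonempty, so the constant map sends
    each to \<open>{v}\<close>, and contiguity reduces to adding \<open>v\<close> to the image under
    \<open>r\<close>.\<close>
  have contig: "contiguous U K r (\<lambda>_. v)"
    if "v \<in> vertices K0" "U \<subseteq> K" "\<And>\<sigma>. \<sigma> \<in> U \<Longrightarrow> insert v (r ` \<sigma>) \<in> K0" for U v
  proof -
    have "(\<lambda>_. v) ` \<sigma> = {v} \<and> r ` \<sigma> \<in> K \<and> insert v (r ` \<sigma>) \<in> K \<and> {v} \<in> K"
      if "\<sigma> \<in> U" for \<sigma>
    proof -
      have "\<sigma> \<in> K"
        using \<open>\<sigma> \<in> U\<close> \<open>U \<subseteq> K\<close> by blast
      then have "(\<lambda>_. v) ` \<sigma> = {v}"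
        using complex_simplex_nonempty[OF assms(1)] by (simp add: image_constant_conv)
      moreover have "{v} \<in> K"
        using vert[OF \<open>v \<in> vertices K0\<close>] by (simp add: vertices_def)
      ultimately show ?thesis
        using r(1)[OF \<open>\<sigma> \<in> K\<close>] \<open>\<And>\<sigma>. \<sigma> \<in> U \<Longrightarrow> insert v (r ` \<sigma>) \<in> K0\<close>[OF \<open>\<sigma> \<in> U\<close>] K0(2) by blast
    qed
    then show ?thesis
      by (simp add: contiguous_def simplicial_map_def)
  qed
  have "scat K < enat (card (vertices K0))"
  proof (rule scat_less_card_cover)
    show "finite (vertices K0)"
      using fin by (rule finite_vertices)
    show "vertices K0 \<noteq> {}"
      using simplex_vertex[OF K0(1) \<sigma>0] complex_simplex_nonempty[OF K0(1) \<sigma>0] by blast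
    \<comment> \<open>A simplex of \<open>K0\<close> lies in the closed star of \<open>v\<close>
      exactly when adding \<open>v\<close> keeps it a simplex, so this is the preimage of that star.
      It contains \<open>{v}\<close> because \<open>r\<close> fixes \<open>v\<close>.\<close>
    show "categorical {\<sigma> \<in> K. insert v (r ` \<sigma>) \<in> K0} K" if v: "v \<in> vertices K0" for v
    proof (rule categorical_if_contiguous_to_constant[OF _ vert[OF v] r(3)])
      show "subcomplex {\<sigma> \<in> K. insert v (r ` \<sigma>) \<in> K0} K"
      proof (rule subcomplex_preimage[OF assms(1), of "{v}"])
        show "{v} \<in> K"
          using vert[OF v] by (simp add: vertices_def)
        show "insert v (r ` {v}) \<in> K0"
          using v r(2)[OF v] by (simp add: vertices_def)
      qed (rule complex_face[OF K0(1)], auto)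
      show "contiguous {\<sigma> \<in> K. insert v (r ` \<sigma>) \<in> K0} K r (\<lambda>_. v)"
        by (rule contig[OF v]) auto
    qed
    show "K \<subseteq> (\<Union>v\<in>vertices K0. {\<sigma> \<in> K. insert v (r ` \<sigma>) \<in> K0})"
    proof
      fix \<sigma> assume \<sigma>: "\<sigma> \<in> K"
      then obtain x where x: "x \<in> r ` \<sigma>"
        using complex_simplex_nonempty[OF K0(1) r(1)] by blast
      \<comment> \<open>Any vertex \<open>x\<close> of the image works, since adding it changes
        nothing.\<close>
      then show "\<sigma> \<in> (\<Union>v\<in>vertices K0. {\<sigma> \<in> K. insert v (r ` \<sigma>) \<in> K0})"
        using \<sigma> r(1)[OF \<sigma>] simplex_vertex[OF K0(1) r(1)[OF \<sigma>] x] insert_absorb[OF x]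
        by (intro UN_I[of x]) simp_all
    qed
  qed
  moreover have "scat K < enat (card (maximal_simplices K0))"
  proof (rule scat_less_card_cover)
    show "finite (maximal_simplices K0)"
      using fin by (simp add: maximal_simplices_def)
    show "maximal_simplices K0 \<noteq> {}"
      using simplex_in_maximal_simplex[OF fin \<sigma>0] by auto
    show "categorical {\<sigma> \<in> K. r ` \<sigma> \<subseteq> \<mu>} K" if "\<mu> \<in> maximal_simplices K0" for \<mu>
    proof -
      have \<mu>: "\<mu> \<in> K0"
        using that by (simp add: maximal_simplices_def)
      \<comment> \<open>Any vertex of \<open>\<mu>\<close> can be the constant value: adding it to a
        nonempty subset of \<open>\<mu>\<close> gives another face of \<open>\<mu>\<close>.\<close>
      then obtain v where v: "v \<in> \<mu>" "v \<in> vertices K0"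
        using complex_simplex_nonempty[OF K0(1)] simplex_vertex[OF K0(1)] by blast
      show ?thesis
      proof (rule categorical_if_contiguous_to_constant[OF _ vert[OF v(2)] r(3)])
        show "subcomplex {\<sigma> \<in> K. r ` \<sigma> \<subseteq> \<mu>} K"
        proof (rule subcomplex_preimage[OF assms(1), of "{v}"])
          show "{v} \<in> K"
            using vert[OF v(2)] by (simp add: vertices_def)
          show "r ` {v} \<subseteq> \<mu>"
            using v r(2) by simp
        qed auto
        show "contiguous {\<sigma> \<in> K. r ` \<sigma> \<subseteq> \<mu>} K r (\<lambda>_. v)"
          by (rule contig[OF v(2)]) (use v(1) complex_face[OF K0(1) \<mu>] in auto)
      qed
    qed
    show "K \<subseteq> (\<Union>\<mu>\<in>maximal_simplices K0. {\<sigma> \<in> K. r ` \<sigma> \<subseteq> \<mu>})"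
    proof
      fix \<sigma> assume \<sigma>: "\<sigma> \<in> K"
      then obtain \<mu> where "\<mu> \<in> maximal_simplices K0" "r ` \<sigma> \<subseteq> \<mu>"
        using simplex_in_maximal_simplex[OF fin r(1)[OF \<sigma>]] by metis
      with \<sigma> show "\<sigma> \<in> (\<Union>\<mu>\<in>maximal_simplices K0. {\<sigma> \<in> K. r ` \<sigma> \<subseteq> \<mu>})"
        by blast
    qed
  qed
  ultimately show ?thesis ..
qed

end
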